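(* Let $n\ge1$, let $\mathcal{C}\subset\mathbb{H}^n$ be a convex set, let $f:\mathcal{C}\to\mathbb{R}$ be a real-differentiable function, and let $\sigma>0$. Then $f$ is $\sigma$-strongly convex if and only if for all $\boldsymbol{p},\boldsymbol{q}\in\mathcal{C}$, $$f(\boldsymbol{q})\geqslant f(\boldsymbol{p})+4\,\mathrm{Re}\left\{\nabla_{\boldsymbol{p}^*}f(\boldsymbol{p})^{\mathsf{H}}(\boldsymbol{q}-\boldsymbol{p})\right\}+\frac{\sigma}{2}\|\boldsymbol{q}-\boldsymbol{p}\|_2^2 .$$
   Context: $\mathbb{H}$ is the algebra of real quaternions $q=q_a+q_bi+q_cj+q_dk$ ($i^2=j^2=k^2=ijk=-1$), with $\mathrm{Re}\{q\}=q_a$ and $q^*=q_a-q_bi-q_cj-q_dk$; $(\cdot)^{\mathsf{H}}$ is the conjugate transpose and $\|\boldsymbol{q}\|_2=\sqrt{\boldsymbol{q}^{\mathsf{H}}\boldsymbol{q}}$. A set $\mathcal{C}\subset\mathbb{H}^n$ is convex if $\theta\boldsymbol{x}+(1-\theta)\boldsymbol{y}\in\mathcal{C}$ for all $\boldsymbol{x},\boldsymbol{y}\in\mathcal{C}$, real $0\le\theta\le1$. For $\sigma>0$, $f:\mathcal{C}\to\mathbb{R}$ is $\sigma$-strongly convex if for all $\boldsymbol{p},\boldsymbol{q}\in\mathcal{C}$ and $\theta\in(0,1)$, $f(\theta\boldsymbol{p}+(1-\theta)\boldsymbol{q})\le\theta f(\boldsymbol{p})+(1-\theta)f(\boldsymbol{q})-\frac{\sigma}{2}\theta(1-\theta)\|\boldsymbol{p}-\boldsymbol{q}\|_2^2$.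 Real-differentiable means that $f$, viewed as a function of the $4n$ real components of $\boldsymbol{q}$, is differentiable at every point of $\mathcal{C}$ ($f$ is defined only on $\mathcal{C}$, so partial derivatives at points of $\mathcal{C}$ are the usual two-sided ones computed from values on $\mathcal{C}$). The quaternion gradient is $\nabla_{\boldsymbol{q}^*}f=\left(\frac{\partial f}{\partial q_1^*},\dots,\frac{\partial f}{\partial q_n^*}\right)^{\mathsf{T}}\in\mathbb{H}^n$ with $\frac{\partial f}{\partial q_l^*}=\frac14\left(\frac{\partial f}{\partial q_{l,a}}+\frac{\partial f}{\partial q_{l,b}}i+\frac{\partial f}{\partial q_{l,c}}j+\frac{\partial f}{\partial q_{l,d}}k\right)$, $q_l=q_{l,a}+q_{l,b}i+q_{l,c}j+q_{l,d}k$; $\nabla_{\boldsymbol{p}^*}f(\boldsymbol{p})$ is its value at $\boldsymbol{p}$. *)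

theory Defs
  imports "HOL-Analysis.Analysis"
begin

section \<open>Real quaternions\<close>

datatype quat = Quat (QRe: real) (QIm1: real) (QIm2: real) (QIm3: real)

lemma quat_eq_iff:
  "x = y \<longleftrightarrow> QRe x = QRe y \<and> QIm1 x = QIm1 y \<and> QIm2 x = QIm2 y \<and> QIm3 x = QIm3 y"
  by (cases x; cases y) simp

instantiation quat :: ring_1
begin

definition zero_quat :: quat where "0 = Quat 0 0 0 0"

definition one_quat :: quat where "1 = Quat 1 0 0 0"

definition plus_quat :: "quat \<Rightarrow> quat \<Rightarrow> quat" where
  "x + y = Quat (QRe x + QRe y) (QIm1 x + QIm1 y) (QIm2 x + QIm2 y) (QIm3 x + QIm3 y)"

definition uminus_quat :: "quat \<Rightarrow> quat" where
  "- x = Quat (- QRe x) (- QIm1 x) (- QIm2 x) (- QIm3 x)"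

definition minus_quat :: "quat \<Rightarrow> quat \<Rightarrow> quat" where
  "x - y = Quat (QRe x - QRe y) (QIm1 x - QIm1 y) (QIm2 x - QIm2 y) (QIm3 x - QIm3 y)"

definition times_quat :: "quat \<Rightarrow> quat \<Rightarrow> quat" where
  "x * y = Quat
     (QRe x * QRe y - QIm1 x * QIm1 y - QIm2 x * QIm2 y - QIm3 x * QIm3 y)
     (QRe x * QIm1 y + QIm1 x * QRe y + QIm2 x * QIm3 y - QIm3 x * QIm2 y)
     (QRe x * QIm2 y - QIm1 x * QIm3 y + QIm2 x * QRe y + QIm3 x * QIm1 y)
     (QRe x * QIm3 y + QIm1 x * QIm2 y - QIm2 x * QIm1 y + QIm3 x * QRe y)"

instance
proof
  note defs = quat_eq_iff zero_quat_def one_quat_def plus_quat_def uminus_quat_def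
    minus_quat_def times_quat_def
  fix x y z :: quat
  show "x * y * z = x * (y * z)" "(x + y) * z = x * z + y * z" "x * (y + z) = x * y + x * z"
    unfolding defs quat.sel by (intro conjI; algebra)+
qed (simp_all add: quat_eq_iff zero_quat_def one_quat_def plus_quat_def uminus_quat_def
  minus_quat_def times_quat_def)

end

instantiation quat :: real_algebra_1
begin

definition scaleR_quat :: "real \<Rightarrow> quat \<Rightarrow> quat" where
  "r *\<^sub>R x = Quat (r * QRe x) (r * QIm1 x) (r * QIm2 x) (r * QIm3 x)"

instance
  by standard
    (simp_all add: quat_eq_iff plus_quat_def times_quat_def scaleR_quat_def algebra_simps)

end

instantiation quat :: real_inner
begin

definition inner_quat :: "quat \<Rightarrow> quat \<Rightarrow> real" where
  "x \<bullet> y = QRe x * QRe y + QIm1 x * QIm1 y + QIm2 x * QIm2 y + QIm3 x * QIm3 y"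

definition norm_quat :: "quat \<Rightarrow> real" where
  "norm x = sqrt ((QRe x)\<^sup>2 + (QIm1 x)\<^sup>2 + (QIm2 x)\<^sup>2 + (QIm3 x)\<^sup>2)"

definition sgn_quat :: "quat \<Rightarrow> quat" where "sgn (x :: quat) = x /\<^sub>R norm x"

definition dist_quat :: "quat \<Rightarrow> quat \<Rightarrow> real" where
  "dist (x :: quat) y = norm (x - y)"

definition uniformity_quat :: "(quat \<times> quat) filter" where
  "uniformity = (INF e\<in>{0<..}. principal {(x :: quat, y). dist x y < e})"

definition open_quat :: "quat set \<Rightarrow> bool" where
  "open (U :: quat set) \<longleftrightarrow> (\<forall>x\<in>U. eventually (\<lambda>(x', y). x' = x \<longrightarrow> y \<in> U) uniformity)"

instance
proof
  fix x y z :: quat and r :: real and U :: "quat set"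
  show "dist x y = norm (x - y)" by (rule dist_quat_def)
  show "sgn x = x /\<^sub>R norm x" by (rule sgn_quat_def)
  show "(uniformity :: (quat \<times> quat) filter) = (INF e\<in>{0<..}. principal {(x, y). dist x y < e})"
    by (rule uniformity_quat_def)
  show "open U \<longleftrightarrow> (\<forall>x\<in>U. \<forall>\<^sub>F (x', y) in uniformity. x' = x \<longrightarrow> y \<in> U)"
    by (rule open_quat_def)
  show "x \<bullet> y = y \<bullet> x" by (simp add: inner_quat_def mult.commute)
  show "(x + y) \<bullet> z = x \<bullet> z + y \<bullet> z"
    by (simp add: inner_quat_def plus_quat_def algebra_simps)
  show "(r *\<^sub>R x) \<bullet> y = r * (x \<bullet> y)"
    by (simp add: inner_quat_def scaleR_quat_def algebra_simps)
  show "0 \<le> x \<bullet> x" by (simp add: inner_quat_def)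
  have "a * a + b * b + c * c + d * d = 0 \<longleftrightarrow> a = 0 \<and> b = 0 \<and> c = 0 \<and> d = 0"
    for a b c d :: real
    by (simp add: add_nonneg_eq_0_iff)
  then show "x \<bullet> x = 0 \<longleftrightarrow> x = 0"
    by (simp add: inner_quat_def quat_eq_iff zero_quat_def)
  show "norm x = sqrt (x \<bullet> x)" by (simp add: norm_quat_def inner_quat_def power2_eq_square)
qed

end

definition qi :: quat where "qi = Quat 0 1 0 0"
definition qj :: quat where "qj = Quat 0 0 1 0"
definition qk :: quat where "qk = Quat 0 0 0 1"

lemma quat_units:
  "qi * qi = -1" "qj * qj = -1" "qk * qk = -1" "qi * qj * qk = -1"
  by (simp_all add: qi_def qj_def qk_def times_quat_def one_quat_def uminus_quat_def)

lemma quat_expansion: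
  "q = of_real (QRe q) + of_real (QIm1 q) * qi + of_real (QIm2 q) * qj + of_real (QIm3 q) * qk"
  by (simp add: quat_eq_iff of_real_def qi_def qj_def qk_def times_quat_def plus_quat_def
      one_quat_def scaleR_quat_def)

instantiation quat :: euclidean_space
begin

definition Basis_quat :: "quat set" where "Basis = {1, qi, qj, qk}"

instance
proof
  show "(Basis :: quat set) \<noteq> {}" "finite (Basis :: quat set)"
    by (simp_all add: Basis_quat_def)
  show "u \<bullet> v = (if u = v then 1 else 0)" if "u \<in> Basis" "v \<in> Basis" for u v :: quat
  proof -
    from that have "u \<in> {Quat 1 0 0 0, Quat 0 1 0 0, Quat 0 0 1 0, Quat 0 0 0 1}"
      "v \<in> {Quat 1 0 0 0, Quat 0 1 0 0, Quat 0 0 1 0, Quat 0 0 0 1}"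
      unfolding Basis_quat_def one_quat_def qi_def qj_def qk_def by this+
    then show ?thesis
      by (elim insertE emptyE; hypsubst; simp add: inner_quat_def)
  qed
  show "(\<forall>u\<in>Basis. x \<bullet> u = 0) \<longleftrightarrow> x = 0" for x :: quat
    unfolding Basis_quat_def one_quat_def qi_def qj_def qk_def quat_eq_iff[of x] zero_quat_def
    by (simp add: inner_quat_def)
qed

end

definition qcnj :: "quat \<Rightarrow> quat" where
  "qcnj q = Quat (QRe q) (- QIm1 q) (- QIm2 q) (- QIm3 q)"

section \<open>Quaternion vectors\<close>

text \<open>The product \<open>x\<^sup>H y\<close> of a conjugate-transposed column with a column.\<close>

definition hprod :: "quat ^ 'n \<Rightarrow> quat ^ 'n \<Rightarrow> quat" where
  "hprod x y = (\<Sum>l\<in>UNIV. qcnj (x $ l) * (y $ l))"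

text \<open>The library norm on \<^typ>\<open>quat ^ 'n\<close> is the norm given by \<open>x\<^sup>H x\<close>.\<close>

lemma hprod_self: "hprod x x = of_real ((norm x)\<^sup>2)"
proof -
  have "qcnj q * q = of_real (q \<bullet> q)" for q :: quat
    by (simp add: qcnj_def times_quat_def inner_quat_def of_real_def one_quat_def
        scaleR_quat_def algebra_simps)
  then show ?thesis
    by (simp add: hprod_def power2_norm_eq_inner inner_vec_def)
qed

lemma norm_eq_hprod: "norm x = sqrt (QRe (hprod x x))"
  by (simp add: hprod_self of_real_def scaleR_quat_def one_quat_def)

section \<open>Differentiation with respect to quaternion variables\<close>

text \<open>
  A function \<open>f : C \<rightarrow> \<real>\<close> is rendered by a total function whose values outside \<open>C\<close> are never
  used: the difference quotients below range over \<open>C\<close> only. In \<open>partial_deriv\<close> the direction \<open>v\<close>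
  is a real coordinate direction \<open>axis l u\<close> with \<open>u \<in> {1, qi, qj, qk}\<close>.
\<close>

definition partial_deriv ::
  "(quat ^ 'n) set \<Rightarrow> (quat ^ 'n \<Rightarrow> real) \<Rightarrow> quat ^ 'n \<Rightarrow> quat ^ 'n \<Rightarrow> real" where
  "partial_deriv C f v p =
     vector_derivative (\<lambda>t. f (p + t *\<^sub>R v)) (at 0 within {t. p + t *\<^sub>R v \<in> C})"

text \<open>
  Besides differentiability relative to \<open>C\<close>, the partial derivatives must be two-sided: around
  each point of \<open>C\<close>, \<open>f\<close> has to be defined on a small segment in every coordinate direction.
\<close>

definition real_differentiable_on ::
  "(quat ^ 'n \<Rightarrow> real) \<Rightarrow> (quat ^ 'n) set \<Rightarrow> bool" where
  "real_differentiable_on f C \<longleftrightarrow>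
     (\<forall>p\<in>C. f differentiable (at p within C) \<and>
        (\<forall>l. \<forall>u\<in>{1, qi, qj, qk}. \<exists>\<epsilon>>0. \<forall>t. \<bar>t\<bar> < \<epsilon> \<longrightarrow> p + t *\<^sub>R axis l u \<in> C))"

definition qgrad :: "(quat ^ 'n) set \<Rightarrow> (quat ^ 'n \<Rightarrow> real) \<Rightarrow> quat ^ 'n \<Rightarrow> quat ^ 'n" where
  "qgrad C f p = (\<chi> l. (1 / 4) *\<^sub>R
     (of_real (partial_deriv C f (axis l 1) p)
      + of_real (partial_deriv C f (axis l qi) p) * qi
      + of_real (partial_deriv C f (axis l qj) p) * qj
      + of_real (partial_deriv C f (axis l qk) p) * qk))"

definition strongly_convex_on ::
  "real \<Rightarrow> (quat ^ 'n) set \<Rightarrow> (quat ^ 'n \<Rightarrow> real) \<Rightarrow> bool" where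
  "strongly_convex_on \<sigma> C f \<longleftrightarrow>
     (\<forall>p\<in>C. \<forall>q\<in>C. \<forall>\<theta>. 0 < \<theta> \<and> \<theta> < 1 \<longrightarrow>
        f (\<theta> *\<^sub>R p + (1 - \<theta>) *\<^sub>R q)
          \<le> \<theta> * f p + (1 - \<theta>) * f q - \<sigma> / 2 * \<theta> * (1 - \<theta>) * (norm (p - q))\<^sup>2)"

end

theory Submission
  imports Defs
begin

text \<open>
  The gradient is only a notation for the real derivative: four times the real part of
  \<open>\<nabla>f(p)\<^sup>H v\<close> is the Euclidean pairing of \<open>v\<close> with the vector of all \<open>4n\<close> real partial
  derivatives, hence the derivative of \<open>f\<close> at \<open>p\<close> applied to \<open>v\<close> (\<open>qgrad_eq_derivative\<close>).

  What remains is a fact about real normed spaces (\<open>strongly_convex_first_order\<close>). Strong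
  convexity bounds every difference quotient of \<open>f\<close> on the segment from \<open>p\<close> towards \<open>q\<close>, and
  letting the step tend to \<open>0\<close> gives the lower bound at \<open>q\<close>. Conversely, the lower bounds at \<open>p\<close>
  and \<open>q\<close>, both taken from \<open>z = \<theta> p + (1 - \<theta>) q\<close>, average with weights \<open>\<theta>\<close> and \<open>1 - \<theta>\<close> to the
  strong convexity inequality: the linear terms cancel because \<open>z\<close> is that same average.
\<close>

lemma has_vector_derivative_along_line:
  fixes f :: "'a::real_normed_vector \<Rightarrow> real"
  assumes "(f has_derivative D) (at p within C)"
  shows "((\<lambda>t. f (p + t *\<^sub>R v)) has_vector_derivative D v) (at 0 within {t. p + t *\<^sub>R v \<in> C})"
proof -
  let ?S = "{t. p + t *\<^sub>R v \<in> C}"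
  let ?g = "\<lambda>t. p + t *\<^sub>R v"
  have g: "(?g has_vector_derivative v) (at 0 within ?S)"
    by (auto intro!: derivative_eq_intros simp: has_vector_derivative_def)
  have "(f has_derivative D) (at (?g 0) within ?g ` ?S)"
    using assms by (auto intro: has_derivative_subset)
  from has_derivative_in_compose[OF g[unfolded has_vector_derivative_def] this]
  show ?thesis
    by (simp add: has_vector_derivative_def linear_cmul[OF has_derivative_linear[OF assms]])
qed

text \<open>
  The difference quotients are needed only for steps in \<open>(0, 1)\<close>, where convexity keeps the point
  in \<open>C\<close>; so the derivative relative to \<open>C\<close> suffices, even at boundary points.
\<close>

lemma strongly_convex_first_order:
  fixes f :: "'a::real_normed_vector \<Rightarrow> real" and \<sigma> :: real
  assumes C: "convex C"
    and D: "\<And>p. p \<in> C \<Longrightarrow> (f has_derivative D p) (at p within C)"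
  shows "(\<forall>p\<in>C. \<forall>q\<in>C. \<forall>\<theta>. 0 < \<theta> \<and> \<theta> < 1 \<longrightarrow>
        f (\<theta> *\<^sub>R p + (1 - \<theta>) *\<^sub>R q)
          \<le> \<theta> * f p + (1 - \<theta>) * f q - \<sigma> / 2 * \<theta> * (1 - \<theta>) * (norm (p - q))\<^sup>2)
    \<longleftrightarrow> (\<forall>p\<in>C. \<forall>q\<in>C. f q \<ge> f p + D p (q - p) + \<sigma> / 2 * (norm (q - p))\<^sup>2)"
    (is "?convex \<longleftrightarrow> ?lower")
proof
  assume conv: ?convex
  show ?lower
  proof (intro ballI)
    fix p q assume pq: "p \<in> C" "q \<in> C"
    define g where "g t = f (p + t *\<^sub>R (q - p))" for t
    let ?S = "{t. p + t *\<^sub>R (q - p) \<in> C}"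
    have segment: "p + t *\<^sub>R (q - p) = t *\<^sub>R q + (1 - t) *\<^sub>R p" for t
      by (simp add: algebra_simps)
    have sub: "{0<..<1} \<subseteq> ?S"
      unfolding segment using pq by (auto intro!: convexD[OF C])
    have "(g has_vector_derivative D p (q - p)) (at 0 within ?S)"
      unfolding g_def by (rule has_vector_derivative_along_line[OF D[OF pq(1)]])
    then have "(g has_field_derivative D p (q - p)) (at 0 within {0<..<1})"
      using sub
      by (auto simp: has_real_derivative_iff_has_vector_derivative
          intro: has_vector_derivative_within_subset)
    then have "((\<lambda>t. (g t - g 0) / t) \<longlongrightarrow> D p (q - p)) (at 0 within {0<..<1})"
      by (simp add: has_field_derivative_iff)
    moreover have "at 0 within {0<..<1} = at_right (0::real)"
      by (rule at_within_nhd[of _ "{..<1}"]) auto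
    ultimately have lim: "((\<lambda>t. (g t - g 0) / t) \<longlongrightarrow> D p (q - p)) (at_right 0)"
      by simp
    have "\<forall>\<^sub>F t in at_right 0.
        (g t - g 0) / t \<le> f q - f p - \<sigma> / 2 * (1 - t) * (norm (q - p))\<^sup>2"
      unfolding eventually_at_right_field
    proof (intro exI[of _ 1] conjI allI impI)
      fix t :: real assume t: "0 < t" "t < 1"
      have "g t \<le> t * f q + (1 - t) * f p - \<sigma> / 2 * t * (1 - t) * (norm (q - p))\<^sup>2"
        unfolding g_def segment using conv pq t by blast
      then have "g t - g 0 \<le> (f q - f p - \<sigma> / 2 * (1 - t) * (norm (q - p))\<^sup>2) * t"
        by (simp add: g_def algebra_simps)
      then show "(g t - g 0) / t \<le> f q - f p - \<sigma> / 2 * (1 - t) * (norm (q - p))\<^sup>2"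
        using t by (simp add: pos_divide_le_eq)
    qed simp
    moreover have "((\<lambda>t. f q - f p - \<sigma> / 2 * (1 - t) * (norm (q - p))\<^sup>2)
        \<longlongrightarrow> f q - f p - \<sigma> / 2 * (1 - 0) * (norm (q - p))\<^sup>2) (at_right 0)"
      by (intro tendsto_intros)
    ultimately have "D p (q - p) \<le> f q - f p - \<sigma> / 2 * (1 - 0) * (norm (q - p))\<^sup>2"
      using lim by (intro tendsto_le[OF trivial_limit_at_right_real])
    then show "f q \<ge> f p + D p (q - p) + \<sigma> / 2 * (norm (q - p))\<^sup>2"
      by simp
  qed
next
  assume lower: ?lower
  show ?convex
  proof (intro ballI allI impI, elim conjE)
    fix p q and \<theta> :: real assume pq: "p \<in> C" "q \<in> C" and \<theta>: "0 < \<theta>" "\<theta> < 1"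
    define z where "z = \<theta> *\<^sub>R p + (1 - \<theta>) *\<^sub>R q"
    define N where "N = (norm (p - q))\<^sup>2"
    define L where "L = D z (p - q)"
    have z: "z \<in> C"
      unfolding z_def using pq \<theta> by (intro convexD[OF C]) auto
    have lin: "D z (c *\<^sub>R (p - q)) = c * L" for c
      by (simp add: L_def linear_cmul[OF has_derivative_linear[OF D[OF z]]])
    have pz: "p - z = (1 - \<theta>) *\<^sub>R (p - q)" and qz: "q - z = (- \<theta>) *\<^sub>R (p - q)"
      by (simp_all add: z_def algebra_simps)
    have "f p \<ge> f z + D z (p - z) + \<sigma> / 2 * (norm (p - z))\<^sup>2"
      using lower z pq by blast
    then have P: "f p \<ge> f z + (1 - \<theta>) * L + \<sigma> / 2 * ((1 - \<theta>)\<^sup>2 * N)"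
      unfolding pz lin by (simp add: N_def power_mult_distrib)
    have "f q \<ge> f z + D z (q - z) + \<sigma> / 2 * (norm (q - z))\<^sup>2"
      using lower z pq by blast
    then have Q: "f q \<ge> f z + (- \<theta>) * L + \<sigma> / 2 * (\<theta>\<^sup>2 * N)"
      unfolding qz lin by (simp add: N_def power_mult_distrib)
    have "\<theta> * (f z + (1 - \<theta>) * L + \<sigma> / 2 * ((1 - \<theta>)\<^sup>2 * N))
        + (1 - \<theta>) * (f z + (- \<theta>) * L + \<sigma> / 2 * (\<theta>\<^sup>2 * N)) \<le> \<theta> * f p + (1 - \<theta>) * f q"
      using P Q \<theta> by (intro add_mono mult_left_mono) auto
    moreover have "\<theta> * (f z + (1 - \<theta>) * L + \<sigma> / 2 * ((1 - \<theta>)\<^sup>2 * N))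
        + (1 - \<theta>) * (f z + (- \<theta>) * L + \<sigma> / 2 * (\<theta>\<^sup>2 * N))
        = f z + \<sigma> / 2 * \<theta> * (1 - \<theta>) * N"
      by (simp add: field_simps power2_eq_square)
    ultimately show "f (\<theta> *\<^sub>R p + (1 - \<theta>) *\<^sub>R q)
        \<le> \<theta> * f p + (1 - \<theta>) * f q - \<sigma> / 2 * \<theta> * (1 - \<theta>) * (norm (p - q))\<^sup>2"
      by (simp add: z_def N_def)
  qed
qed

text \<open>
  A small segment of the line lies in \<open>C\<close>, so \<open>0\<close> is not isolated in the set of admissible
  parameters; without this the partial derivative would be an arbitrary value.
\<close>

lemma partial_deriv_eq:
  assumes D: "(f has_derivative D) (at p within C)"
    and \<epsilon>: "\<epsilon> > 0" "\<And>t. \<bar>t\<bar> < \<epsilon> \<Longrightarrow> p + t *\<^sub>R v \<in> C"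
  shows "partial_deriv C f v p = D v"
proof -
  have "{-\<epsilon><..<\<epsilon>} \<subseteq> {t. p + t *\<^sub>R v \<in> C}"
    using \<epsilon>(2) by auto
  then have "0 \<in> interior {t. p + t *\<^sub>R v \<in> C}"
    using \<epsilon>(1) by (intro interiorI[of "{-\<epsilon><..<\<epsilon>}"]) auto
  then have "at 0 within {t. p + t *\<^sub>R v \<in> C} = at 0"
    by (rule at_within_interior)
  then show ?thesis
    using has_vector_derivative_along_line[OF D, of v]
    by (simp add: partial_deriv_def vector_derivative_at)
qed

lemma linear_quat_vec_expansion:
  fixes D :: "quat ^ 'n \<Rightarrow> real"
  assumes D: "linear D"
  shows "D v = (\<Sum>l\<in>UNIV. QRe (v $ l) * D (axis l 1) + QIm1 (v $ l) * D (axis l qi)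
      + QIm2 (v $ l) * D (axis l qj) + QIm3 (v $ l) * D (axis l qk))"
proof -
  have axis: "axis l q = QRe q *\<^sub>R axis l 1 + QIm1 q *\<^sub>R axis l qi + QIm2 q *\<^sub>R axis l qj
      + QIm3 q *\<^sub>R axis l qk" for l :: 'n and q
    by (simp add: vec_eq_iff axis_def quat_eq_iff zero_quat_def one_quat_def qi_def qj_def qk_def
        plus_quat_def scaleR_quat_def)
  have "v = (\<Sum>l\<in>UNIV. axis l (v $ l))"
    by (simp add: vec_eq_iff axis_def)
  then have "D v = (\<Sum>l\<in>UNIV. D (axis l (v $ l)))"
    by (metis linear_sum[OF D])
  also have "\<dots> = (\<Sum>l\<in>UNIV. QRe (v $ l) * D (axis l 1) + QIm1 (v $ l) * D (axis l qi)
      + QIm2 (v $ l) * D (axis l qj) + QIm3 (v $ l) * D (axis l qk))"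
    by (subst axis) (simp add: linear_add[OF D] linear_cmul[OF D])
  finally show ?thesis .
qed

lemma QRe_hprod: "QRe (hprod x y) = (\<Sum>l\<in>UNIV. x $ l \<bullet> y $ l)"
proof -
  have "QRe (\<Sum>l\<in>A. g l) = (\<Sum>l\<in>A. QRe (g l))" if "finite A" for A :: "'a set" and g
    using that by induction (simp_all add: zero_quat_def plus_quat_def)
  then show ?thesis
    by (simp add: hprod_def qcnj_def times_quat_def inner_quat_def)
qed

text \<open>The factor \<open>4\<close> undoes the \<open>1/4\<close> in the quaternion partial derivatives.\<close>

lemma qgrad_eq_derivative:
  fixes f :: "quat ^ 'n \<Rightarrow> real"
  assumes D: "(f has_derivative D) (at p within C)"
    and seg: "\<And>l u. u \<in> {1, qi, qj, qk} \<Longrightarrow> \<exists>\<epsilon>>0. \<forall>t. \<bar>t\<bar> < \<epsilon> \<longrightarrow> p + t *\<^sub>R axis l u \<in> C"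
  shows "4 * QRe (hprod (qgrad C f p) v) = D v"
proof -
  have pd: "partial_deriv C f (axis l u) p = D (axis l u)" if "u \<in> {1, qi, qj, qk}" for l u
    using seg[OF that, of l] partial_deriv_eq[OF D] by blast
  have "4 * (qgrad C f p $ l \<bullet> v $ l) = QRe (v $ l) * D (axis l 1) + QIm1 (v $ l) * D (axis l qi)
      + QIm2 (v $ l) * D (axis l qj) + QIm3 (v $ l) * D (axis l qk)" for l
    by (simp add: qgrad_def pd inner_quat_def of_real_def one_quat_def qi_def qj_def qk_def
        times_quat_def plus_quat_def scaleR_quat_def field_simps)
  then show ?thesis
    unfolding QRe_hprod sum_distrib_left
    by (simp add: linear_quat_vec_expansion[OF has_derivative_linear[OF D], of v])
qed

theorem mainTheorem4:
  fixes C :: "(quat ^ 'n) set" and f :: "quat ^ 'n \<Rightarrow> real" and \<sigma> :: real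
  assumes "convex C"
    and "real_differentiable_on f C"
    and "\<sigma> > 0"
  shows "strongly_convex_on \<sigma> C f \<longleftrightarrow>
    (\<forall>p\<in>C. \<forall>q\<in>C. f q \<ge> f p + 4 * QRe (hprod (qgrad C f p) (q - p)) + \<sigma> / 2 * (norm (q - p))\<^sup>2)"
proof -
  define D where "D p = frechet_derivative f (at p within C)" for p
  have D: "(f has_derivative D p) (at p within C)" if "p \<in> C" for p
    using assms(2) that
    by (simp add: D_def real_differentiable_on_def flip: frechet_derivative_works)
  have "4 * QRe (hprod (qgrad C f p) v) = D p v" if "p \<in> C" for p v
    using assms(2) that
    by (intro qgrad_eq_derivative[OF D]) (simp_all only: real_differentiable_on_def)
  then show ?thesis
    using strongly_convex_first_order[OF assms(1) D, where \<sigma> = \<sigma>]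
    by (simp add: strongly_convex_on_def)
qed

end
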